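(* For every integer $k\geq 3$, the $3$-qubit gate $W_k=V_{3,k}\,T(c_1,c_2,t_3)$ (the Toffoli gate followed by $V_{3,k}$) belongs to $\mathcal{C}_{k+1}$ but is not a semi-Clifford operation. Here $T(c_1,c_2,t_3)$ is the Toffoli gate on three qubits with qubits 1 and 2 as controls and qubit 3 as target, i.e. $|a,b,c\rangle\mapsto|a,b,c\oplus ab\rangle$ for $a,b,c\in\{0,1\}$, and $V_{3,k}=I\otimes I\otimes\mathrm{diag}(1,e^{i\pi/2^{k-1}})$ is the single-qubit gate $\mathrm{diag}(1,e^{i\pi/2^{k-1}})$ acting on the third qubit.
   Context: An $n$-qubit gate is a unitary operator on $(\mathbb{C}^2)^{\otimes n}$; here $n=3$. The $n$-qubit Pauli group $\mathcal{P}_n$ is the group of order $4^{n+1}$ of all operators $c\,\sigma_1\otimes\cdots\otimes\sigma_n$ with $c\in\{\pm1,\pm i\}$ and $\sigma_j\in\{I,X,Y,Z\}$ (the identity and the Pauli matrices). The sets $\mathcal{C}_k$ (for fixed $n$) are defined recursively as sets of $n$-qubit unitaries: $\mathcal{C}_1=\mathcal{P}_n$ and $\mathcal{C}_{k+1}=\{U : U\mathcal{C}_1U^{\dagger}\subseteq\mathcal{C}_k\}$ for $k\ge 1$. An $n$-qubit unitary $U$ is called semi-Clifford if there is at least one maximal abelian subgroup $G$ of $\mathcal{P}_n$ such that $UGU^{\dagger}$ is a maximal abelian subgroup of $\mathcal{P}_n$ (possibly equal to $G$). *)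

theory Defs
  imports "HOL-Analysis.Analysis" "HOL-Algebra.Group"
begin

text \<open>
  The qubits are labelled by a finite type \<open>'n\<close>, so \<open>bool ^ 'n\<close> is the set of bit strings
  (\<open>False\<close> for 0, \<open>True\<close> for 1) labelling the computational basis of the \<open>n\<close>-fold tensor power
  of \<open>\<complex>\<^sup>2\<close>. An operator is given by its matrix in this basis: the entry
  \<open>A $ x $ y\<close> is \<open>\<langle>x|A|y\<rangle>\<close>.
\<close>

type_synonym qubit_op = "complex ^ bool ^ bool"
type_synonym 'n qop = "complex ^ (bool ^ 'n) ^ (bool ^ 'n)"

definition mat2 :: "complex \<Rightarrow> complex \<Rightarrow> complex \<Rightarrow> complex \<Rightarrow> qubit_op" where
  "mat2 a b c d = (\<chi> i j. if i then (if j then d else c) else (if j then b else a))"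

definition pauli_I :: qubit_op where "pauli_I = mat2 1 0 0 1"
definition pauli_X :: qubit_op where "pauli_X = mat2 0 1 1 0"
definition pauli_Y :: qubit_op where "pauli_Y = mat2 0 (- \<i>) \<i> 0"
definition pauli_Z :: qubit_op where "pauli_Z = mat2 1 0 0 (- 1)"

definition tensor_op :: "('n \<Rightarrow> qubit_op) \<Rightarrow> 'n::finite qop" where
  "tensor_op A = (\<chi> x y. \<Prod>j\<in>UNIV. A j $ (x $ j) $ (y $ j))"

definition scale_op :: "complex \<Rightarrow> 'n::finite qop \<Rightarrow> 'n qop" where
  "scale_op c A = (\<chi> x y. c * A $ x $ y)"

definition dagger :: "'n::finite qop \<Rightarrow> 'n qop" where
  "dagger A = (\<chi> x y. cnj (A $ y $ x))"

definition unitary_op :: "'n::finite qop \<Rightarrow> bool" where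
  "unitary_op U \<longleftrightarrow> U ** dagger U = mat 1 \<and> dagger U ** U = mat 1"

definition conj_op :: "'n::finite qop \<Rightarrow> 'n qop \<Rightarrow> 'n qop" where
  "conj_op U A = U ** A ** dagger U"

definition pauli_group :: "'n::finite qop monoid" where
  "pauli_group =
    \<lparr> carrier = {scale_op c (tensor_op s) | c s.
        c \<in> {1, - 1, \<i>, - \<i>} \<and> (\<forall>j. s j \<in> {pauli_I, pauli_X, pauli_Y, pauli_Z})},
      mult = (**), one = mat 1 \<rparr>"

text \<open>The hierarchy is indexed from 1; level 0 is a dummy value.\<close>

fun gate_hierarchy :: "nat \<Rightarrow> 'n::finite qop set" where
  "gate_hierarchy 0 = {}"
| "gate_hierarchy (Suc 0) = carrier pauli_group"
| "gate_hierarchy (Suc (Suc k)) =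
    {U. unitary_op U \<and> conj_op U ` gate_hierarchy (Suc 0) \<subseteq> gate_hierarchy (Suc k)}"

definition abelian_subgroup :: "'a set \<Rightarrow> ('a, 'b) monoid_scheme \<Rightarrow> bool" where
  "abelian_subgroup H P \<longleftrightarrow> subgroup H P \<and> comm_group (P\<lparr>carrier := H\<rparr>)"

definition maximal_abelian_subgroup :: "'a set \<Rightarrow> ('a, 'b) monoid_scheme \<Rightarrow> bool" where
  "maximal_abelian_subgroup G P \<longleftrightarrow>
    abelian_subgroup G P \<and> (\<forall>H. abelian_subgroup H P \<and> G \<subseteq> H \<longrightarrow> H = G)"

definition semi_Clifford :: "'n::finite qop \<Rightarrow> bool" where
  "semi_Clifford U \<longleftrightarrow> unitary_op U \<and>
    (\<exists>G. maximal_abelian_subgroup G pauli_group \<and>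
         maximal_abelian_subgroup (conj_op U ` G) pauli_group)"

definition toffoli :: "'n \<Rightarrow> 'n \<Rightarrow> 'n \<Rightarrow> 'n::finite qop" where
  "toffoli c1 c2 t =
    (\<chi> x y. if x = (\<chi> j. if j = t then y $ t \<noteq> (y $ c1 \<and> y $ c2) else y $ j) then 1 else 0)"

definition single_qubit_gate :: "'n \<Rightarrow> qubit_op \<Rightarrow> 'n::finite qop" where
  "single_qubit_gate j A = tensor_op (\<lambda>i. if i = j then A else mat 1)"

definition V_gate :: "'n \<Rightarrow> nat \<Rightarrow> 'n::finite qop" where
  "V_gate j k = single_qubit_gate j (mat2 1 0 0 (exp (\<i> * pi / 2 ^ (k - 1))))"

text \<open>
  The three qubits are the elements \<open>1\<close>, \<open>2\<close>, \<open>3\<close> of the three-element numeral type \<open>3\<close>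
  (where \<open>3 = 0\<close>). The matrix product applies the right factor first.
\<close>

definition W_gate :: "nat \<Rightarrow> 3 qop" where
  "W_gate k = V_gate 3 k ** toffoli 1 2 3"

end

theory Submission
  imports Defs
begin

text \<open>
  \<open>W\<^sub>k\<close> is monomial, and the Toffoli permutation conjugates a translation of bit strings to an
  affine permutation. So \<open>W\<^sub>k P W\<^sub>k\<^sup>\<dagger>\<close>, for a Pauli \<open>P\<close>, is an affine permutation times a phase
  function built from signs of quadratic forms and from \<open>\<omega>\<^bsup>u\<^esup>\<close> and \<open>\<omega>\<^bsup>-u\<^esup>\<close> with
  \<open>\<omega> = exp (\<i> \<pi> / 2\<^bsup>k-1\<^esup>)\<close> and \<open>u\<close> an affine function with values in \<open>{0, 1}\<close>. A shift of the argument
  changes \<open>\<omega>\<^bsup>u\<^esup>\<close> by a constant and a power \<open>\<omega>\<^bsup>-2u\<^esup>\<close>, so it goes down one level at each step.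

  On the other hand \<open>W\<^sub>k P W\<^sub>k\<^sup>\<dagger>\<close> can be a Pauli only if \<open>P\<close> is diagonal. A maximal abelian subgroup
  that \<open>W\<^sub>k\<close> maps into the Pauli group is therefore the group of all diagonal Paulis, which contains
  \<open>Z\<^sub>3\<close>; but \<open>W\<^sub>k Z\<^sub>3 W\<^sub>k\<^sup>\<dagger>\<close> is \<open>Z\<^sub>3\<close> times a controlled \<open>Z\<close>.
\<close>

section \<open>Affine maps on bit strings\<close>

text \<open>HOL-Algebra takes the notation \<open>inv\<close> for the group inverse.\<close>

abbreviation inv_fun :: "('a \<Rightarrow> 'b) \<Rightarrow> 'b \<Rightarrow> 'a" where
  "inv_fun \<equiv> Hilbert_Choice.inv"

definition bxor :: "bool ^ 'n \<Rightarrow> bool ^ 'n \<Rightarrow> bool ^ 'n" where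
  "bxor x a = (\<chi> j. x $ j \<noteq> a $ j)"

text \<open>Over the two-element field a function is affine iff every translation of the argument
  changes it by a constant. This form feeds directly into the shift quotients of
  \<open>phase_level\<close>.\<close>

definition affine_bit :: "(bool ^ 'n \<Rightarrow> bool) \<Rightarrow> bool" where
  "affine_bit u \<longleftrightarrow> (\<forall>a. \<exists>e. \<forall>x. u (bxor x a) = (u x \<noteq> e))"

definition affine_map :: "(bool ^ 'n \<Rightarrow> bool ^ 'n) \<Rightarrow> bool" where
  "affine_map p \<longleftrightarrow> (\<forall>a. \<exists>b. \<forall>x. p (bxor x a) = bxor (p x) b)"

definition sgn_bit :: "bool \<Rightarrow> complex" where
  "sgn_bit b = (if b then - 1 else 1)"

lemma bxor_nth [simp]: "bxor x a $ j = (x $ j \<noteq> a $ j)"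
  by (simp add: bxor_def)

lemma bxor_cancel [simp]: "bxor (bxor x a) a = x"
  unfolding vec_eq_iff bxor_nth by blast

lemma bxor_swap: "bxor (bxor x a) b = bxor (bxor x b) a"
  unfolding vec_eq_iff bxor_nth by blast

lemma bxor_assoc: "bxor (bxor x a) b = bxor x (bxor a b)"
  unfolding vec_eq_iff bxor_nth by blast

lemma bxor_left_cancel [simp]: "bxor x a = bxor x b \<longleftrightarrow> a = b"
  unfolding vec_eq_iff bxor_nth by blast

lemma bxor_zero [simp]: "bxor x (\<chi> j. False) = x"
  by (simp add: vec_eq_iff)

lemma bij_bxor: "bij (\<lambda>x. bxor x a)"
  by (rule o_bij[of "\<lambda>x. bxor x a"]) auto

lemma inv_bxor: "inv_fun (\<lambda>x. bxor x a) = (\<lambda>x. bxor x a)"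
  by (rule inv_unique_comp) auto

lemma affine_bitE:
  assumes "affine_bit u"
  obtains e where "\<And>x. u (bxor x a) = (u x \<noteq> e)"
proof -
  have "\<exists>e. \<forall>x. u (bxor x a) = (u x \<noteq> e)"
    using assms unfolding affine_bit_def by (rule spec)
  then show thesis
    using that by (elim exE) simp
qed

lemma affine_mapE:
  assumes "affine_map p"
  obtains b where "\<And>x. p (bxor x a) = bxor (p x) b"
proof -
  have "\<exists>b. \<forall>x. p (bxor x a) = bxor (p x) b"
    using assms unfolding affine_map_def by (rule spec)
  then show thesis
    using that by (elim exE) simp
qed

lemma affine_bit_const: "affine_bit (\<lambda>x. c)"
  unfolding affine_bit_def by (intro allI exI[of _ False]) simp

lemma affine_bit_nth: "affine_bit (\<lambda>x. x $ j)"
  unfolding affine_bit_def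
proof
  show "\<exists>e. \<forall>x. bxor x a $ j = (x $ j \<noteq> e)" for a
    by (intro exI[of _ "a $ j"]) simp
qed

lemma affine_bit_xor:
  assumes "affine_bit u" "affine_bit v"
  shows "affine_bit (\<lambda>x. u x \<noteq> v x)"
  unfolding affine_bit_def
proof
  fix a
  obtain d where "\<And>x. u (bxor x a) = (u x \<noteq> d)"
    using assms(1) by (rule affine_bitE[where a = a]) (rule that)
  moreover obtain e where "\<And>x. v (bxor x a) = (v x \<noteq> e)"
    using assms(2) by (rule affine_bitE[where a = a]) (rule that)
  ultimately show "\<exists>e. \<forall>x. (u (bxor x a) \<noteq> v (bxor x a)) = ((u x \<noteq> v x) \<noteq> e)"
    by (intro exI[of _ "d \<noteq> e"]) (cases d; cases e; simp)
qed

lemma affine_bit_and_const: "affine_bit u \<Longrightarrow> affine_bit (\<lambda>x. c \<and> u x)"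
  by (cases c) (simp_all add: affine_bit_const)

lemmas affine_bit_intros =
  affine_bit_const affine_bit_nth affine_bit_xor affine_bit_and_const

lemma affine_bit_comp: "affine_bit u \<Longrightarrow> affine_map p \<Longrightarrow> affine_bit (\<lambda>x. u (p x))"
  unfolding affine_bit_def[of "\<lambda>x. u (p x)"]
  by (metis affine_bitE affine_mapE)

lemma affine_map_componentwise:
  assumes "\<And>j. affine_bit (\<lambda>x. p x $ j)"
  shows "affine_map p"
  unfolding affine_map_def
proof
  fix a
  have "\<forall>j. \<exists>e. \<forall>x. p (bxor x a) $ j = (p x $ j \<noteq> e)"
    using assms unfolding affine_bit_def by blast
  from choice[OF this] obtain e where "\<forall>j x. p (bxor x a) $ j = (p x $ j \<noteq> e j)"
    by (rule exE)
  then show "\<exists>b. \<forall>x. p (bxor x a) = bxor (p x) b"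
    by (intro exI[of _ "\<chi> j. e j"]) (simp add: vec_eq_iff)
qed

lemma affine_map_bxor: "affine_map (\<lambda>x. bxor x a)"
  unfolding affine_map_def using bxor_swap by blast

text \<open>Affine bijections normalise the translations, so conjugation by them keeps the
  permutation part of a Pauli a translation.\<close>

lemma affine_map_conj_bxor:
  assumes "affine_map p" "bij p"
  obtains b where "\<And>y. p (bxor (inv_fun p y) a) = bxor y b"
proof -
  obtain b where "\<And>x. p (bxor x a) = bxor (p x) b"
    using assms(1) by (rule affine_mapE[where a = a]) (rule that)
  then show thesis
    using that[of b] assms(2) by (simp add: bij_is_surj surj_f_inv_f)
qed

lemma affine_map_inv:
  assumes "affine_map p" "bij p"
  shows "affine_map (inv_fun p)"
  unfolding affine_map_def
proof
  fix a
  \<comment> \<open>The preimage under \<open>p\<close> of \<open>p 0\<close> shifted by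
    \<open>a\<close>. Evaluation at 0 then identifies the shift \<open>c\<close> induced by
    \<open>b\<close> with \<open>a\<close>.\<close>
  define b where "b = bxor (inv_fun p (bxor (p (\<chi> j. False)) a)) (\<chi> j. False)"
  obtain c where c: "\<And>x. p (bxor x b) = bxor (p x) c"
    using assms(1) by (rule affine_mapE[where a = b]) (rule that)
  have "bxor (\<chi> j. False) b = b"
    by (simp add: vec_eq_iff)
  then have "p b = bxor (p (\<chi> j. False)) c"
    using c[of "\<chi> j. False"] by simp
  moreover have "p b = bxor (p (\<chi> j. False)) a"
    unfolding b_def using assms(2) by (simp add: bij_is_surj surj_f_inv_f)
  ultimately have "c = a"
    by simp
  then have "inv_fun p (bxor y a) = bxor (inv_fun p y) b" for y
    using c[of "inv_fun p y"] assms(2) by (metis bij_inv_eq_iff)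
  then show "\<exists>b. \<forall>x. inv_fun p (bxor x a) = bxor (inv_fun p x) b"
    by blast
qed

lemma sgn_bit_simps [simp]:
  "sgn_bit True = - 1" "sgn_bit False = 1" "cnj (sgn_bit b) = sgn_bit b" "norm (sgn_bit b) = 1"
  by (auto simp: sgn_bit_def)

lemma sgn_bit_xor: "sgn_bit (a \<noteq> b) = sgn_bit a * sgn_bit b"
  by (auto simp: sgn_bit_def)

text \<open>Passes from translations to coordinates: starting at the zero string, the set bits of
  \<open>x\<close> are switched on one at a time, and each switch is a translation by a unit vector,
  which contributes a fixed sign.\<close>

lemma sgn_affine_bit_eq_prod:
  assumes "affine_bit (u :: bool ^ 'n::finite \<Rightarrow> bool)"
  obtains e b where "\<And>x. sgn_bit (u x) = sgn_bit e * (\<Prod>j\<in>UNIV. sgn_bit (b j \<and> x $ j))"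
proof -
  define unit :: "'n \<Rightarrow> bool ^ 'n" where "unit i = (\<chi> j. j = i)" for i
  obtain e where e: "\<forall>a x. u (bxor x a) = (u x \<noteq> e a)"
    using choice[OF assms[unfolded affine_bit_def]] by blast
  define b where "b i = e (unit i)" for i
  have b: "u (bxor x (unit i)) = (u x \<noteq> b i)" for i x
    using e by (simp add: b_def)
  have restr: "sgn_bit (u (\<chi> j. j \<in> S \<and> x $ j)) =
      sgn_bit (u (\<chi> j. False)) * (\<Prod>j\<in>S. sgn_bit (b j \<and> x $ j))" for S x
  proof (induction S rule: finite_induct[OF finite])
    case (2 i S)
    have "(\<chi> j. j \<in> insert i S \<and> x $ j) =
        (if x $ i then bxor (\<chi> j. j \<in> S \<and> x $ j) (unit i) else (\<chi> j. j \<in> S \<and> x $ j))"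
      using 2(2) by (auto simp: vec_eq_iff unit_def)
    then have "sgn_bit (u (\<chi> j. j \<in> insert i S \<and> x $ j)) =
        sgn_bit (u (\<chi> j. j \<in> S \<and> x $ j)) * sgn_bit (b i \<and> x $ i)"
      by (simp add: b sgn_bit_xor[symmetric])
    then show ?case
      using 2 by (simp add: mult_ac)
  qed simp
  have "sgn_bit (u x) = sgn_bit (u (\<chi> j. False)) * (\<Prod>j\<in>UNIV. sgn_bit (b j \<and> x $ j))" for x
    using restr[of UNIV x] by simp
  then show thesis
    by (rule that)
qed

section \<open>Phase functions\<close>

abbreviation fourth_roots :: "complex set" where
  "fourth_roots \<equiv> {1, - 1, \<i>, - \<i>}"

text \<open>The polynomial form makes closure under products a computation with powers, and later
  excludes \<open>root_phase (m + 2)\<close>.\<close>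

lemma fourth_roots_iff: "c \<in> fourth_roots \<longleftrightarrow> c ^ 4 = 1"
proof
  assume "c ^ 4 = 1"
  then have "(c - 1) * (c + 1) * ((c - \<i>) * (c + \<i>)) = 0"
    by (simp add: algebra_simps power4_eq_xxxx)
  then show "c \<in> fourth_roots"
    by (auto simp: eq_neg_iff_add_eq_0)
qed (auto simp: power4_eq_xxxx)

lemma fourth_roots_mult: "c \<in> fourth_roots \<Longrightarrow> d \<in> fourth_roots \<Longrightarrow> c * d \<in> fourth_roots"
  unfolding fourth_roots_iff by (simp add: power_mult_distrib)

text \<open>Diagonal part of level \<open>m + 1\<close> of the hierarchy: conjugating a bit flip by a diagonal
  operator leaves a quotient of shifted phases.\<close>

fun phase_level :: "nat \<Rightarrow> (bool ^ 'n \<Rightarrow> complex) set" where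
  "phase_level 0 = {\<lambda>x. c * sgn_bit (u x) | c u. c \<in> fourth_roots \<and> affine_bit u}"
| "phase_level (Suc m) = {f. (\<forall>x. norm (f x) = 1) \<and>
    (\<forall>a. (\<lambda>x. f (bxor x a) * cnj (f x)) \<in> phase_level m)}"

declare phase_level.simps [simp del]

lemma phase_level_SucI:
  assumes "\<And>x. norm (f x) = 1" "\<And>a. (\<lambda>x. f (bxor x a) * cnj (f x)) \<in> phase_level m"
  shows "f \<in> phase_level (Suc m)"
  using assms by (simp add: phase_level.simps)

lemma phase_level_SucD:
  "f \<in> phase_level (Suc m) \<Longrightarrow> (\<lambda>x. f (bxor x a) * cnj (f x)) \<in> phase_level m"
  by (simp add: phase_level.simps)

lemma phase_level_0I:
  "c \<in> fourth_roots \<Longrightarrow> affine_bit u \<Longrightarrow> (\<lambda>x. c * sgn_bit (u x)) \<in> phase_level 0"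
  by (simp only: phase_level.simps) blast

lemma phase_level_0E:
  assumes "f \<in> phase_level 0"
  obtains c u where "c \<in> fourth_roots" "affine_bit u" "f = (\<lambda>x. c * sgn_bit (u x))"
  using assms by (simp only: phase_level.simps) blast

lemma phase_level_norm: "f \<in> phase_level m \<Longrightarrow> norm (f x) = 1"
  by (cases m) (auto simp: phase_level.simps norm_mult)

text \<open>The shift quotient of a product is the product of the shift quotients; at level 0 the
  sign exponents are added by xor.\<close>

lemma phase_level_mult:
  "f \<in> phase_level m \<Longrightarrow> g \<in> phase_level m \<Longrightarrow> (\<lambda>x. f x * g x) \<in> phase_level m"
proof (induction m arbitrary: f g)
  case 0
  obtain c u where f: "c \<in> fourth_roots" "affine_bit u" "f = (\<lambda>x. c * sgn_bit (u x))"
    using 0(1) by (rule phase_level_0E)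
  obtain d v where g: "d \<in> fourth_roots" "affine_bit v" "g = (\<lambda>x. d * sgn_bit (v x))"
    using 0(2) by (rule phase_level_0E)
  from phase_level_0I[OF fourth_roots_mult[OF f(1) g(1)] affine_bit_xor[OF f(2) g(2)]] show ?case
    unfolding f(3) g(3) sgn_bit_xor by (simp add: mult_ac)
next
  case (Suc m)
  have "(\<lambda>x. (f (bxor x a) * cnj (f x)) * (g (bxor x a) * cnj (g x))) \<in> phase_level m" for a
    by (intro Suc.IH phase_level_SucD Suc.prems)
  then show ?case
    using Suc.prems[THEN phase_level_norm]
    by (intro phase_level_SucI) (simp_all add: norm_mult mult_ac)
qed

lemma phase_level_cnj: "f \<in> phase_level m \<Longrightarrow> (\<lambda>x. cnj (f x)) \<in> phase_level m"
proof (induction m arbitrary: f)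
  case 0
  then obtain c u where f: "c \<in> fourth_roots" "affine_bit u" "f = (\<lambda>x. c * sgn_bit (u x))"
    by (rule phase_level_0E)
  have "cnj c \<in> fourth_roots"
    using f(1) by auto
  from phase_level_0I[OF this f(2)] show ?case
    by (simp add: f(3))
next
  case (Suc m)
  have "(\<lambda>x. cnj (f (bxor x a) * cnj (f x))) \<in> phase_level m" for a
    by (intro Suc.IH phase_level_SucD Suc.prems)
  then show ?case
    using phase_level_norm[OF Suc.prems] by (intro phase_level_SucI) simp_all
qed

lemma phase_level_0_const: "c \<in> fourth_roots \<Longrightarrow> (\<lambda>x. c) \<in> phase_level 0"
  using phase_level_0I[OF _ affine_bit_const[of False]] by simp

lemma phase_level_one: "(\<lambda>x. 1) \<in> phase_level m"
  by (induction m) (simp_all add: phase_level_0_const phase_level_SucI)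

lemma phase_level_const: "norm c = 1 \<Longrightarrow> (\<lambda>x. c) \<in> phase_level (Suc m)"
  by (intro phase_level_SucI) (simp_all add: complex_norm_square[symmetric] phase_level_one)

lemma phase_level_sgn: "affine_bit u \<Longrightarrow> (\<lambda>x. sgn_bit (u x)) \<in> phase_level 0"
  using phase_level_0I[of 1 u] by simp

text \<open>At level 0 the scalar cancels against its conjugate and the affine exponent changes by a
  constant, so the shift quotient is a constant sign.\<close>

lemma phase_level_Suc: "f \<in> phase_level m \<Longrightarrow> f \<in> phase_level (Suc m)"
proof (induction m arbitrary: f)
  case 0
  then obtain c u where f: "c \<in> fourth_roots" "affine_bit u" "f = (\<lambda>x. c * sgn_bit (u x))"
    by (rule phase_level_0E)
  have "(\<lambda>x. f (bxor x a) * cnj (f x)) \<in> phase_level 0" for a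
  proof -
    obtain e where e: "\<And>x. u (bxor x a) = (u x \<noteq> e)"
      using f(2) by (rule affine_bitE[where a = a]) (rule that)
    have "f (bxor x a) * cnj (f x) = sgn_bit e" for x
      using f(1) by (auto simp: f(3) e sgn_bit_def)
    then show ?thesis
      using phase_level_sgn[OF affine_bit_const[of e]] by simp
  qed
  then show ?case
    using phase_level_norm[OF 0] by (intro phase_level_SucI)
next
  case (Suc m)
  show ?case
    by (rule phase_level_SucI[OF phase_level_norm[OF Suc.prems]
          Suc.IH[OF phase_level_SucD[OF Suc.prems]]])
qed

lemma phase_level_mono: "m \<le> l \<Longrightarrow> f \<in> phase_level m \<Longrightarrow> f \<in> phase_level l"
  by (induction rule: dec_induct) (auto intro: phase_level_Suc)

text \<open>\<open>p\<close> turns a shift of its argument into a shift of its value, so a shift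
  quotient of the composite is a shift quotient of \<open>f\<close> composed with
  \<open>p\<close>.\<close>

lemma phase_level_comp:
  assumes "affine_map p"
  shows "f \<in> phase_level m \<Longrightarrow> (\<lambda>x. f (p x)) \<in> phase_level m"
proof (induction m arbitrary: f)
  case 0
  then obtain c u where f: "c \<in> fourth_roots" "affine_bit u" "f = (\<lambda>x. c * sgn_bit (u x))"
    by (rule phase_level_0E)
  show ?case
    using phase_level_0I[OF f(1) affine_bit_comp[OF f(2) assms]] by (simp add: f(3))
next
  case (Suc m)
  have "(\<lambda>x. f (p (bxor x a)) * cnj (f (p x))) \<in> phase_level m" for a
  proof -
    obtain b where "\<And>x. p (bxor x a) = bxor (p x) b"
      using assms by (rule affine_mapE[where a = a]) (rule that)
    then show ?thesis
      using Suc.IH[OF phase_level_SucD[OF Suc.prems, of b]] by simp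
  qed
  then show ?case
    using phase_level_norm[OF Suc.prems] by (intro phase_level_SucI)
qed

lemma phase_level_0_prod:
  assumes "finite S" "\<And>i. i \<in> S \<Longrightarrow> f i \<in> phase_level 0"
  shows "(\<lambda>x. \<Prod>i\<in>S. f i x) \<in> phase_level 0"
  using assms
  by (induction S rule: finite_induct)
    (simp_all add: phase_level_one phase_level_mult)

section \<open>Roots of unity of two-power order\<close>

text \<open>A primitive \<open>2^(m+1)\<close>-th root of unity; the phase in
  \<open>V_gate j k\<close> is \<open>root_phase (k - 1)\<close>.\<close>

definition root_phase :: "nat \<Rightarrow> complex" where
  "root_phase m = cis (pi / 2 ^ m)"

lemma norm_root_phase [simp]: "norm (root_phase m) = 1"
  by (simp add: root_phase_def)

lemma root_phase_mult_cnj [simp]: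
  "root_phase m * cnj (root_phase m) = 1" "cnj (root_phase m) * root_phase m = 1"
  by (simp_all add: root_phase_def cis_cnj cis_mult)

lemma root_phase_0: "root_phase 0 = - 1"
  by (simp add: root_phase_def)

lemma root_phase_1: "root_phase (Suc 0) = \<i>"
  by (simp add: root_phase_def)

lemma root_phase_square: "root_phase (Suc m) * root_phase (Suc m) = root_phase m"
  by (simp add: root_phase_def cis_mult field_simps)

text \<open>The fourth power is \<open>root_phase m\<close>, which has -1 among its powers. This is
  where \<open>k \<ge> 3\<close> enters: the phase of the gate is not a Pauli scalar.\<close>

lemma root_phase_4_neq_1: "root_phase (m + 2) ^ 4 \<noteq> 1"
proof -
  have pow: "root_phase m ^ 2 ^ m = - 1" for m
    by (induction m) (simp_all add: root_phase_0 power_mult power2_eq_square root_phase_square)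
  have "root_phase (m + 2) ^ 4 = root_phase m"
    using root_phase_square[of m] root_phase_square[of "Suc m"]
    by (simp add: power4_eq_xxxx mult_ac)
  then show ?thesis
    using pow[of m] by auto
qed

text \<open>The step: a shift either fixes the bit, or replaces \<open>z\<close> by \<open>1 - z\<close>,
  and \<open>(1 - z) - z = 1 - 2 z\<close>.\<close>

lemma phase_level_root:
  assumes "affine_bit u"
  shows "(\<lambda>x. if u x then root_phase m else 1) \<in> phase_level m"
proof (induction m)
  case 0
  show ?case
    using phase_level_sgn[OF assms] unfolding root_phase_0 sgn_bit_def .
next
  case (Suc m)
  let ?f = "\<lambda>l x. if u x then root_phase l else 1"
  have const: "(\<lambda>x. root_phase (Suc m)) \<in> phase_level m"
  \<comment> \<open>Level 0 admits only fourth roots of unity as constants, and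
    \<open>root_phase (Suc 0)\<close> is one of them; every higher level admits all constants of
    norm 1.\<close>
  proof (cases m)
    case 0
    then show ?thesis
      using phase_level_0_const[of \<i>] by (simp add: root_phase_1)
  next
    case (Suc l)
    then show ?thesis
      using phase_level_const[of "root_phase (Suc m)" l] by simp
  qed
  have "(\<lambda>x. ?f (Suc m) (bxor x a) * cnj (?f (Suc m) x)) \<in> phase_level m" for a
  proof -
    obtain e where e: "\<And>x. u (bxor x a) = (u x \<noteq> e)"
      using assms by (rule affine_bitE[where a = a]) (rule that)
    show ?thesis
    proof (cases e)
      case True
      \<comment> \<open>For a flipped bit the quotient is \<open>root_phase (Suc m)\<close> or its
        conjugate, according to \<open>u x\<close>; this identity merges both cases into
        \<open>root_phase (Suc m) * cnj (?f m x)\<close>.\<close>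
      have "cnj (root_phase (Suc m)) = root_phase (Suc m) * cnj (root_phase m)"
        unfolding root_phase_square[of m, symmetric] complex_cnj_mult mult.assoc[symmetric] by simp
      then have "(\<lambda>x. ?f (Suc m) (bxor x a) * cnj (?f (Suc m) x)) =
          (\<lambda>x. root_phase (Suc m) * cnj (?f m x))"
        using True by (auto simp: e)
      then show ?thesis
        using phase_level_mult[OF const phase_level_cnj[OF Suc.IH]] by simp
    next
      case False
      then have "(\<lambda>x. ?f (Suc m) (bxor x a) * cnj (?f (Suc m) x)) = (\<lambda>x. 1)"
        by (auto simp: e)
      then show ?thesis
        using phase_level_one by simp
    qed
  qed
  then show ?case
    by (intro phase_level_SucI) simp_all
qed

text \<open>The sign is \<open>\<i>\<^bsup>2zw\<^esup>\<close>, and \<open>2 z w = z + w - (z xor w)\<close> for bits \<open>z\<close>, \<open>w\<close>.\<close>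

lemma phase_level_sgn_and:
  assumes "affine_bit u" "affine_bit v"
  shows "(\<lambda>x. sgn_bit (u x \<and> v x)) \<in> phase_level (Suc 0)"
proof -
  let ?f = "\<lambda>u x. if u x then root_phase (Suc 0) else 1"
  have "(\<lambda>x. ?f u x * ?f v x * cnj (?f (\<lambda>x. u x \<noteq> v x) x)) \<in> phase_level (Suc 0)"
    by (intro phase_level_mult phase_level_cnj phase_level_root affine_bit_xor assms)
  moreover have "(\<lambda>x. ?f u x * ?f v x * cnj (?f (\<lambda>x. u x \<noteq> v x) x)) = (\<lambda>x. sgn_bit (u x \<and> v x))"
    by (rule ext) (simp add: root_phase_1 sgn_bit_def)
  ultimately show ?thesis
    by simp
qed

section \<open>Monomial operators\<close>

lemma qop_eqI: "(\<And>x y. A $ x $ y = B $ x $ y) \<Longrightarrow> A = (B :: 'n::finite qop)"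
  by (simp add: vec_eq_iff[where 'b = "bool ^ 'n"] vec_eq_iff[where 'b = "bool ^ 'n" and 'a = complex])

text \<open>Sends the basis vector \<open>y\<close> to \<open>f y\<close> times the basis vector
  \<open>p y\<close>; the phase is read at the input string.\<close>

definition monomial_op :: "(bool ^ 'n \<Rightarrow> bool ^ 'n) \<Rightarrow> (bool ^ 'n \<Rightarrow> complex) \<Rightarrow> 'n::finite qop" where
  "monomial_op p f = (\<chi> x y. if x = p y then f y else 0)"

lemma monomial_op_nth: "monomial_op p f $ x $ y = (if x = p y then f y else 0)"
  by (simp add: monomial_op_def)

lemma monomial_op_mult:
  "monomial_op p f ** monomial_op q g = monomial_op (\<lambda>y. p (q y)) (\<lambda>y. f (q y) * g y)"
proof -
  have "(\<Sum>z\<in>UNIV. (if x = p z then f z else 0) * (if z = q y then g y else 0)) =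
      (\<Sum>z\<in>UNIV. if z = q y then (if x = p (q y) then f (q y) * g y else 0) else 0)" for x y
    by (rule sum.cong) auto
  then show ?thesis
    by (intro qop_eqI) (simp add: matrix_matrix_mult_def monomial_op_def)
qed

lemma monomial_op_one: "mat 1 = monomial_op (\<lambda>x. x) (\<lambda>x. 1)"
  by (intro qop_eqI) (simp add: mat_def monomial_op_def)

lemma dagger_monomial_op:
  "bij p \<Longrightarrow> dagger (monomial_op p f) = monomial_op (inv_fun p) (\<lambda>y. cnj (f (inv_fun p y)))"
  by (intro qop_eqI) (auto simp: dagger_def monomial_op_def bij_is_inj bij_is_surj surj_f_inv_f)

lemma monomial_op_unitary:
  assumes "bij p" "\<And>x. norm (f x) = 1"
  shows "unitary_op (monomial_op p f)"
proof -
  have "f x * cnj (f x) = 1" for x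
    using assms(2)[of x] by (simp add: complex_norm_square[symmetric])
  moreover from this have "cnj (f x) * f x = 1" for x
    by (simp add: mult.commute)
  ultimately show ?thesis
    using assms(1)
    by (simp add: unitary_op_def dagger_monomial_op monomial_op_mult monomial_op_one
        bij_is_surj surj_f_inv_f bij_is_inj)
qed

text \<open>When \<open>q\<close> is a translation, the factor formed from \<open>f\<close> is the
  shift quotient of \<open>phase_level\<close>, taken at \<open>inv_fun p y\<close>.\<close>

lemma conj_monomial_op:
  assumes "bij p"
  shows "conj_op (monomial_op p f) (monomial_op q g) =
    monomial_op (\<lambda>y. p (q (inv_fun p y))) (\<lambda>y. f (q (inv_fun p y)) * cnj (f (inv_fun p y)) * g (inv_fun p y))"
  using assms by (simp add: conj_op_def dagger_monomial_op monomial_op_mult mult_ac)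

section \<open>Paulis as translations with level-0 phases\<close>

text \<open>Symplectic labelling by the X and Z exponents, so that two bit strings describe a tensor
  product of Pauli matrices.\<close>

definition pauli_of :: "bool \<Rightarrow> bool \<Rightarrow> qubit_op" where
  "pauli_of a b = (if a then if b then pauli_Y else pauli_X else if b then pauli_Z else pauli_I)"

lemma pauli_of_nth:
  "pauli_of a b $ x $ y = (if x = (y \<noteq> a) then (if a \<and> b then \<i> else 1) * sgn_bit (b \<and> y) else 0)"
  by (cases a; cases b; cases x; cases y)
    (simp_all add: pauli_of_def pauli_I_def pauli_X_def pauli_Y_def pauli_Z_def mat2_def)

text \<open>Since Y = iXZ, each qubit with both bits set contributes a factor i. A single coordinate
  in which the row is not the shifted column makes the whole product vanish.\<close>

lemma scale_tensor_pauli_of: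
  "scale_op c (tensor_op (\<lambda>j. pauli_of (a $ j) (b j))) =
    monomial_op (\<lambda>x. bxor x a)
      (\<lambda>x. c * (\<Prod>j\<in>UNIV. if a $ j \<and> b j then \<i> else 1) * (\<Prod>j\<in>UNIV. sgn_bit (b j \<and> x $ j)))"
proof -
  have "(\<Prod>j\<in>UNIV. pauli_of (a $ j) (b j) $ (x $ j) $ (y $ j)) =
      (if x = bxor y a then (\<Prod>j\<in>UNIV. if a $ j \<and> b j then \<i> else 1) *
        (\<Prod>j\<in>UNIV. sgn_bit (b j \<and> y $ j)) else 0)" for x y
  proof (cases "x = bxor y a")
    case True
    then show ?thesis
      by (simp add: pauli_of_nth prod.distrib)
  next
    case False
    then obtain j where "x $ j \<noteq> (y $ j \<noteq> a $ j)"
      by (auto simp: vec_eq_iff)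
    then have "\<exists>j\<in>UNIV. pauli_of (a $ j) (b j) $ (x $ j) $ (y $ j) = 0"
      unfolding pauli_of_nth by auto
    then show ?thesis
      using False by (simp only: prod_zero[OF finite] if_False)
  qed
  then show ?thesis
    by (intro qop_eqI) (simp add: scale_op_def tensor_op_def monomial_op_def)
qed

lemma fourth_roots_prod:
  assumes "\<And>j. j \<in> S \<Longrightarrow> f j \<in> fourth_roots"
  shows "(\<Prod>j\<in>S. f j) \<in> fourth_roots"
  using assms unfolding fourth_roots_iff by (simp add: prod_power_distrib)

text \<open>The factors i coming from Y are absorbed into the scalar, and the remaining product of
  signs is the general affine sign by \<open>sgn_affine_bit_eq_prod\<close>.\<close>

lemma carrier_pauli_group:
  "carrier pauli_group =
    {monomial_op (\<lambda>x. bxor x a) f | (a :: bool ^ 'n::finite) f. f \<in> phase_level 0}"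
  (is "_ = ?M")
proof
  show "carrier pauli_group \<subseteq> ?M"
  proof
    fix P :: "'n qop"
    assume "P \<in> carrier pauli_group"
    then obtain c s where P: "P = scale_op c (tensor_op s)" "c \<in> fourth_roots"
      and s: "\<forall>j. s j \<in> {pauli_I, pauli_X, pauli_Y, pauli_Z}"
      by (auto simp: pauli_group_def)
    have "\<forall>j. \<exists>a b. s j = pauli_of a b"
      using s unfolding pauli_of_def by (metis empty_iff insert_iff)
    then obtain a b where ab: "s = (\<lambda>j. pauli_of (a j) (b j))"
      by metis
    define a' where "a' = (\<chi> j. a j)"
    define d where "d = c * (\<Prod>j\<in>UNIV. if a' $ j \<and> b j then \<i> else 1)"
    have "P = monomial_op (\<lambda>x. bxor x a') (\<lambda>x. d * (\<Prod>j\<in>UNIV. sgn_bit (b j \<and> x $ j)))"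
      using scale_tensor_pauli_of[of c a' b] by (simp add: P(1) ab d_def a'_def)
    moreover have "d \<in> fourth_roots"
      unfolding d_def by (intro fourth_roots_mult fourth_roots_prod P(2)) auto
    then have "(\<lambda>x. d * (\<Prod>j\<in>UNIV. sgn_bit (b j \<and> x $ j))) \<in> phase_level 0"
      by (intro phase_level_mult phase_level_0_const phase_level_0_prod phase_level_sgn
          affine_bit_and_const affine_bit_nth) simp_all
    ultimately show "P \<in> ?M"
      by blast
  qed
  show "?M \<subseteq> carrier pauli_group"
  proof
    fix P :: "'n qop"
    assume "P \<in> ?M"
    then obtain a f where P: "P = monomial_op (\<lambda>x. bxor x a) f" "f \<in> phase_level 0"
      by blast
    then obtain c u where f: "c \<in> fourth_roots" "affine_bit u" "f = (\<lambda>x. c * sgn_bit (u x))"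
      by (blast elim: phase_level_0E)
    obtain e b where u: "\<And>x. sgn_bit (u x) = sgn_bit e * (\<Prod>j\<in>UNIV. sgn_bit (b j \<and> x $ j))"
      using sgn_affine_bit_eq_prod[OF f(2)] by blast
    \<comment> \<open>The factors \<open>- \<i>\<close> compensate the factor i that each Y puts
      into the tensor product.\<close>
    define d where "d = c * sgn_bit e * (\<Prod>j\<in>UNIV. if a $ j \<and> b j then - \<i> else 1)"
    have "(\<Prod>j\<in>UNIV. if a $ j \<and> b j then - \<i> else 1) * (\<Prod>j\<in>UNIV. if a $ j \<and> b j then \<i> else 1) = 1"
      unfolding prod.distrib[symmetric] by (rule prod.neutral) auto
    then have "P = scale_op d (tensor_op (\<lambda>j. pauli_of (a $ j) (b j)))"
      unfolding scale_tensor_pauli_of P(1) f(3) u d_def by (simp add: mult_ac)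
    moreover have "sgn_bit e \<in> fourth_roots"
      by (simp add: sgn_bit_def)
    then have "d \<in> fourth_roots"
      unfolding d_def by (intro fourth_roots_mult fourth_roots_prod f(1)) auto
    ultimately show "P \<in> carrier pauli_group"
      unfolding pauli_group_def partial_object.select_convs mem_Collect_eq
      by (intro exI[of _ d] exI[of _ "\<lambda>j. pauli_of (a $ j) (b j)"] conjI allI)
        (simp_all add: pauli_of_def)
  qed
qed

lemma pauli_groupE:
  assumes "P \<in> carrier pauli_group"
  obtains a f where "P = monomial_op (\<lambda>x. bxor x a) f" "f \<in> phase_level 0"
  using assms unfolding carrier_pauli_group by blast

lemma mult_pauli_group [simp]: "x \<otimes>\<^bsub>pauli_group\<^esub> y = x ** y"
  by (simp add: pauli_group_def)

lemma one_pauli_group [simp]: "\<one>\<^bsub>pauli_group\<^esub> = monomial_op (\<lambda>x. x) (\<lambda>x. 1)"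
  by (simp add: pauli_group_def monomial_op_one)

section \<open>Membership in the hierarchy\<close>

lemma gate_hierarchy_SucI:
  assumes "unitary_op U" "\<And>P. P \<in> carrier pauli_group \<Longrightarrow> conj_op U P \<in> gate_hierarchy (Suc m)"
  shows "U \<in> gate_hierarchy (Suc (Suc m))"
  using assms by auto

text \<open>The phase of the conjugate is a shift quotient of \<open>f\<close>, hence one level
  lower, times the level-0 phase of the Pauli, all composed with the affine inverse of
  \<open>p\<close>.\<close>

lemma conj_affine_monomial_op:
  assumes "affine_map p" "bij p" "f \<in> phase_level (Suc m)" "P \<in> carrier pauli_group"
  obtains b g where "conj_op (monomial_op p f) P = monomial_op (\<lambda>x. bxor x b) g" "g \<in> phase_level m"
proof -
  obtain a h where P: "P = monomial_op (\<lambda>x. bxor x a) h" "h \<in> phase_level 0"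
    using assms(4) by (rule pauli_groupE)
  obtain b where b: "\<And>y. p (bxor (inv_fun p y) a) = bxor y b"
    using affine_map_conj_bxor[OF assms(1,2)] by metis
  have "(\<lambda>x. f (bxor x a) * cnj (f x) * h x) \<in> phase_level m"
    by (intro phase_level_mult phase_level_SucD assms(3) phase_level_mono[OF le0 P(2)])
  from phase_level_comp[OF affine_map_inv[OF assms(1,2)] this] show thesis
    by (rule that[rotated]) (simp add: P(1) conj_monomial_op[OF assms(2)] b)
qed

text \<open>Each conjugation of a Pauli returns a translation with a phase one level lower, down to
  the Paulis. The offset of one arises because the hierarchy is indexed from 1.\<close>

lemma shift_monomial_op_in_hierarchy:
  "f \<in> phase_level m \<Longrightarrow> monomial_op (\<lambda>x. bxor x a) f \<in> gate_hierarchy (Suc m)"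
proof (induction m arbitrary: a f)
  case 0
  then show ?case
    using carrier_pauli_group by auto
next
  case (Suc m)
  show ?case
  proof (rule gate_hierarchy_SucI)
    show "unitary_op (monomial_op (\<lambda>x. bxor x a) f)"
      using monomial_op_unitary[OF bij_bxor] phase_level_norm[OF Suc.prems] by blast
    show "conj_op (monomial_op (\<lambda>x. bxor x a) f) P \<in> gate_hierarchy (Suc m)"
      if "P \<in> carrier pauli_group" for P
      using conj_affine_monomial_op[OF affine_map_bxor bij_bxor Suc.prems that] Suc.IH by metis
  qed
qed

text \<open>One conjugation reduces to translations. The levels start at 2 because an affine
  permutation need not be a Pauli.\<close>

lemma affine_monomial_op_in_hierarchy:
  assumes "affine_map p" "bij p" "f \<in> phase_level (Suc m)"
  shows "monomial_op p f \<in> gate_hierarchy (Suc (Suc m))"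
proof (rule gate_hierarchy_SucI)
  show "unitary_op (monomial_op p f)"
    using monomial_op_unitary[OF assms(2)] phase_level_norm[OF assms(3)] by blast
  show "conj_op (monomial_op p f) P \<in> gate_hierarchy (Suc m)"
    if "P \<in> carrier pauli_group" for P
    using conj_affine_monomial_op[OF assms that] shift_monomial_op_in_hierarchy by metis
qed

section \<open>The Toffoli permutation and the gate \<open>W_gate\<close>\<close>

definition toffoli_map :: "bool ^ 3 \<Rightarrow> bool ^ 3" where
  "toffoli_map y = (\<chi> j. if j = 3 then y $ 3 \<noteq> (y $ 1 \<and> y $ 2) else y $ j)"

lemma toffoli_map_nth [simp]:
  "toffoli_map y $ 1 = y $ 1" "toffoli_map y $ 2 = y $ 2"
  "toffoli_map y $ 3 = (y $ 3 \<noteq> (y $ 1 \<and> y $ 2))"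
  by (simp_all add: toffoli_map_def)

lemma toffoli_map_involution [simp]: "toffoli_map (toffoli_map y) = y"
  by (auto simp: vec_eq_iff forall_3)

lemma bij_toffoli_map: "bij toffoli_map"
  by (rule o_bij[of toffoli_map]) auto

lemma inv_toffoli_map: "inv_fun toffoli_map = toffoli_map"
  by (rule inv_unique_comp) auto

lemma V_gate_monomial: "V_gate j (Suc m) = monomial_op (\<lambda>x. x) (\<lambda>x. if x $ j then root_phase m else 1)"
proof -
  let ?A = "mat2 1 0 0 (root_phase m)"
  have A: "(if i = j then ?A else mat 1) $ x $ y = (if x = y then if i = j \<and> y then root_phase m else 1 else 0)" for i x y
    by (cases x; cases y) (simp_all add: mat2_def mat_def)
  have "(\<Prod>i\<in>UNIV. (if i = j then ?A else mat 1) $ (x $ i) $ (y $ i)) =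
      (if x = y then if y $ j then root_phase m else 1 else 0)" for x y :: "bool ^ 'a"
  proof (cases "x = y")
    case True
    then have "(\<Prod>i\<in>UNIV. (if i = j then ?A else mat 1) $ (x $ i) $ (y $ i)) =
        (\<Prod>i\<in>UNIV. if i = j then if y $ j then root_phase m else 1 else 1)"
      unfolding A by (intro prod.cong) auto
    then show ?thesis
      using True by simp
  next
    case False
    then obtain i where "x $ i \<noteq> y $ i"
      by (auto simp: vec_eq_iff)
    then have "\<exists>i\<in>UNIV. (if i = j then ?A else mat 1) $ (x $ i) $ (y $ i) = 0"
      unfolding A by auto
    then show ?thesis
      using False by (simp only: prod_zero[OF finite] if_False)
  qed
  moreover have "exp (\<i> * pi / 2 ^ m) = root_phase m"
    by (simp add: root_phase_def cis_conv_exp)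
  ultimately show ?thesis
    by (intro qop_eqI) (simp add: V_gate_def single_qubit_gate_def tensor_op_def monomial_op_def)
qed

text \<open>The diagonal gate acts after the Toffoli gate, so its phase reads the third bit of the
  image.\<close>

definition W_phase :: "nat \<Rightarrow> bool ^ 3 \<Rightarrow> complex" where
  "W_phase m x = (if toffoli_map x $ 3 then root_phase m else 1)"

lemma W_gate_monomial: "W_gate (Suc m) = monomial_op toffoli_map (W_phase m)"
proof -
  have "toffoli 1 2 3 = monomial_op toffoli_map (\<lambda>x. 1)"
    by (intro qop_eqI) (simp add: toffoli_def monomial_op_def toffoli_map_def)
  then show ?thesis
    by (simp add: W_gate_def V_gate_monomial monomial_op_mult W_phase_def[abs_def] del: toffoli_map_nth)
qed

lemma norm_W_phase: "norm (W_phase m x) = 1"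
  by (simp add: W_phase_def)

lemma W_gate_unitary: "unitary_op (W_gate (Suc m))"
  unfolding W_gate_monomial by (rule monomial_op_unitary[OF bij_toffoli_map norm_W_phase])

text \<open>The Toffoli map is quadratic, so its conjugate of a translation is affine.\<close>

definition W_shift :: "bool ^ 3 \<Rightarrow> bool ^ 3 \<Rightarrow> bool ^ 3" where
  "W_shift a y = toffoli_map (bxor (toffoli_map y) a)"

text \<open>In the third bit, expanding \<open>(y1 + a1)(y2 + a2)\<close> modulo 2 produces a second
  \<open>y1 y2\<close>, which cancels the one from the inner Toffoli map.\<close>

lemma W_shift_nth:
  "W_shift a y $ 1 = (y $ 1 \<noteq> a $ 1)" "W_shift a y $ 2 = (y $ 2 \<noteq> a $ 2)"
  "W_shift a y $ 3 =
    (y $ 3 \<noteq> ((a $ 1 \<and> y $ 2) \<noteq> ((a $ 2 \<and> y $ 1) \<noteq> (a $ 3 \<noteq> (a $ 1 \<and> a $ 2)))))"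
  by (auto simp: W_shift_def)

lemma affine_bit_W_shift_nth: "affine_bit (\<lambda>y. W_shift a y $ j)"
proof -
  have "\<forall>j. affine_bit (\<lambda>y. W_shift a y $ j)"
    unfolding forall_3 W_shift_nth by (intro conjI affine_bit_intros)
  then show ?thesis
    by blast
qed

lemma bij_W_shift: "bij (W_shift a)"
  by (rule o_bij[of "W_shift a"]) (auto simp: W_shift_def)

text \<open>The Toffoli map is its own inverse, so \<open>W_phase\<close> at
  \<open>toffoli_map y\<close> reads just \<open>y $ 3\<close>, and after the shift it reads the
  third bit of \<open>W_shift a y\<close>. Both bits are affine in \<open>y\<close>.\<close>

lemma conj_W_gate:
  "conj_op (W_gate (Suc m)) (monomial_op (\<lambda>x. bxor x a) h) =
    monomial_op (W_shift a) (\<lambda>y. (if W_shift a y $ 3 then root_phase m else 1) *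
      cnj (if y $ 3 then root_phase m else 1) * h (toffoli_map y))"
  unfolding W_gate_monomial conj_monomial_op[OF bij_toffoli_map] inv_toffoli_map
  by (simp add: W_phase_def W_shift_def[abs_def] del: toffoli_map_nth)

text \<open>Only the third coordinate is changed, so a sign character with coefficient
  \<open>b 3\<close> there gains the quadratic sign of \<open>b 3 \<and> y $ 1 \<and> y $ 2\<close>,
  which has level 1.\<close>

lemma phase_level_comp_toffoli_map:
  assumes "h \<in> phase_level 0"
  shows "(\<lambda>y. h (toffoli_map y)) \<in> phase_level (Suc m)"
proof -
  obtain c u where h: "c \<in> fourth_roots" "affine_bit u" "h = (\<lambda>x. c * sgn_bit (u x))"
    using assms by (rule phase_level_0E)
  obtain e b where u: "\<And>x. sgn_bit (u x) = sgn_bit e * (\<Prod>j\<in>UNIV. sgn_bit (b j \<and> x $ j))"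
    using sgn_affine_bit_eq_prod[OF h(2)] by blast
  have "h (toffoli_map y) = h y * sgn_bit ((b 3 \<and> y $ 1) \<and> y $ 2)" for y
    unfolding h(3) u UNIV_3 by (auto simp: sgn_bit_def)
  moreover have "(\<lambda>y. h y * sgn_bit ((b 3 \<and> y $ 1) \<and> y $ 2)) \<in> phase_level (Suc 0)"
    by (intro phase_level_mult phase_level_Suc[OF assms] phase_level_sgn_and affine_bit_intros)
  ultimately show ?thesis
    using phase_level_mono[of "Suc 0" "Suc m"] by simp
qed

text \<open>With \<open>k = m + 2\<close>, the factors of \<open>root_phase (m + 1)\<close> have
  phase level \<open>m + 1\<close>, so the affine conjugates lie in level
  \<open>m + 2 = k\<close>.\<close>

lemma W_gate_in_hierarchy: "W_gate (Suc (Suc m)) \<in> gate_hierarchy (Suc (Suc (Suc m)))"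
proof (rule gate_hierarchy_SucI)
  fix P :: "3 qop"
  assume "P \<in> carrier pauli_group"
  then obtain a h where P: "P = monomial_op (\<lambda>x. bxor x a) h" "h \<in> phase_level 0"
    by (rule pauli_groupE)
  show "conj_op (W_gate (Suc (Suc m))) P \<in> gate_hierarchy (Suc (Suc m))"
    unfolding P(1) conj_W_gate
    by (intro affine_monomial_op_in_hierarchy affine_map_componentwise affine_bit_W_shift_nth
        bij_W_shift phase_level_mult phase_level_cnj phase_level_root affine_bit_nth
        phase_level_comp_toffoli_map P(2))
qed (rule W_gate_unitary)

section \<open>Failure of the semi-Clifford property\<close>

text \<open>A column determines its permutation value only if its entry is nonzero.\<close>

lemma monomial_op_eqD:
  assumes "monomial_op p f = monomial_op q g" "f x \<noteq> 0"
  shows "p x = q x" "f x = g x"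
proof -
  have "monomial_op q g $ p x $ x = f x"
    by (simp flip: assms(1) add: monomial_op_nth)
  with assms(2) show "p x = q x" "f x = g x"
    by (auto simp: monomial_op_nth split: if_splits)
qed

lemma phase_level_0_fourth_root: "h \<in> phase_level 0 \<Longrightarrow> h x \<in> fourth_roots"
  by (erule phase_level_0E) (auto simp: sgn_bit_def)

text \<open>A Pauli has a translation as its permutation part, which forces the linear terms of
  \<open>W_shift a\<close> to vanish; a remaining flip of the target would leave a phase that is not
  a fourth root of unity.\<close>

lemma conj_W_gate_pauli_imp_diagonal:
  assumes "h \<in> phase_level 0"
    and "conj_op (W_gate (m + 3)) (monomial_op (\<lambda>x. bxor x a) h) \<in> carrier pauli_group"
  shows "a = (\<chi> j. False)"
proof -
  define F where "F = (\<lambda>y. (if W_shift a y $ 3 then root_phase (m + 2) else 1) *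
      cnj (if y $ 3 then root_phase (m + 2) else 1) * h (toffoli_map y))"
  have "monomial_op (W_shift a) F \<in> carrier pauli_group"
    using assms(2) conj_W_gate[of "m + 2" a h] by (simp add: F_def numeral_3_eq_3 del: toffoli_map_nth)
  then obtain b g where bg: "monomial_op (W_shift a) F = monomial_op (\<lambda>x. bxor x b) g"
      and g: "g \<in> phase_level 0"
    by (rule pauli_groupE)
  have "norm (F y) = 1" for y
    using phase_level_norm[OF assms(1)] by (simp add: F_def norm_mult)
  then have "F y \<noteq> 0" for y
    by (metis norm_zero zero_neq_one)
  note eqs = monomial_op_eqD[OF bg this]
  have b3: "W_shift a y $ 3 = (y $ 3 \<noteq> b $ 3)" for y
    by (simp add: eqs(1))
  define e :: "3 \<Rightarrow> bool ^ 3" where "e i = (\<chi> j. j = i)" for i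
  \<comment> \<open>In the third bit of \<open>W_shift a y\<close> the coefficients of
    \<open>y $ 1\<close> and \<open>y $ 2\<close> are \<open>a $ 2\<close> and \<open>a $ 1\<close>;
    comparing the unit strings with zero isolates them.\<close>
  have a12: "\<not> a $ 1" "\<not> a $ 2"
    using b3[of "\<chi> j. False"] b3[of "e 1"] b3[of "e 2"] by (auto simp: W_shift_nth e_def)
  have "\<not> a $ 3"
  proof
    assume "a $ 3"
    \<comment> \<open>At the zero string the flipped target bit contributes the root, while the
      conjugate factor is 1.\<close>
    then have "F (\<chi> j. False) = root_phase (m + 2) * h (toffoli_map (\<chi> j. False))"
      using a12 by (simp add: F_def W_shift_nth)
    moreover have "F (\<chi> j. False) \<in> fourth_roots"
      using eqs(2) phase_level_0_fourth_root[OF g] by simp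
    ultimately show False
      using phase_level_0_fourth_root[OF assms(1), of "toffoli_map (\<chi> j. False)"]
        root_phase_4_neq_1[of m]
      unfolding fourth_roots_iff by (simp add: power_mult_distrib)
  qed
  with a12 show ?thesis
    by (simp add: vec_eq_iff forall_3)
qed

text \<open>For the zero shift the phases of the diagonal gate cancel, leaving the sign with
  exponent \<open>y3 + y1 y2\<close>, which is not affine.\<close>

lemma conj_W_gate_Z3_not_pauli:
  "conj_op (W_gate (Suc m)) (monomial_op (\<lambda>x. x) (\<lambda>x. sgn_bit (x $ 3))) \<notin> carrier pauli_group"
proof
  define F :: "bool ^ 3 \<Rightarrow> complex" where "F = (\<lambda>y. sgn_bit (toffoli_map y $ 3))"
  have id: "W_shift (\<chi> j. False) = (\<lambda>y. y)"
    by (simp add: W_shift_def[abs_def])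
  have cancel: "(if b then root_phase m else 1) * cnj (if b then root_phase m else 1) * z = z" for b z
    by simp
  have "conj_op (W_gate (Suc m)) (monomial_op (\<lambda>x. x) (\<lambda>x. sgn_bit (x $ 3))) = monomial_op (\<lambda>x. x) F"
    using conj_W_gate[of m "\<chi> j. False" "\<lambda>x. sgn_bit (x $ 3)"]
    unfolding id cancel bxor_zero F_def .
  moreover assume "conj_op (W_gate (Suc m)) (monomial_op (\<lambda>x. x) (\<lambda>x. sgn_bit (x $ 3)))
    \<in> carrier pauli_group"
  ultimately obtain b g where bg: "monomial_op (\<lambda>x. x) F = monomial_op (\<lambda>x. bxor x b) g"
      and g: "g \<in> phase_level 0"
    by (metis pauli_groupE)
  have "F y \<noteq> 0" for y
    by (simp add: F_def sgn_bit_def)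
  note eq = monomial_op_eqD(2)[OF bg this]
  obtain c u where u: "c \<in> fourth_roots" "affine_bit u" "g = (\<lambda>x. c * sgn_bit (u x))"
    using g by (rule phase_level_0E)
  define e :: "3 \<Rightarrow> bool ^ 3" where "e i = (\<chi> j. j = i)" for i
  define z :: "bool ^ 3" where "z = (\<chi> j. False)"
  obtain d where d: "\<And>x. u (bxor x (e 2)) = (u x \<noteq> d)"
    using u(2) by (rule affine_bitE[where a = "e 2"]) (rule that)
  \<comment> \<open>Flipping bit 2 preserves the sign at \<open>z\<close> but changes it at
    \<open>e 1\<close>, contradicting the constant change \<open>d\<close>.\<close>
  have "F z = 1" "F (bxor z (e 2)) = 1" "F (e 1) = 1" "F (bxor (e 1) (e 2)) = - 1"
    by (simp_all add: F_def z_def e_def)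
  then show False
    unfolding eq u(3) d by (auto simp: sgn_bit_def split: if_splits)
qed

section \<open>Group structure of the Paulis and of the diagonal Paulis\<close>

lemma pauli_group_group: "group (pauli_group :: 'n::finite qop monoid)"
proof (rule groupI)
  fix P Q :: "'n qop"
  assume "P \<in> carrier pauli_group" "Q \<in> carrier pauli_group"
  then obtain a f b g where PQ: "P = monomial_op (\<lambda>x. bxor x a) f" "f \<in> phase_level 0"
    "Q = monomial_op (\<lambda>x. bxor x b) g" "g \<in> phase_level 0"
    by (metis pauli_groupE)
  have "(\<lambda>y. f (bxor y b) * g y) \<in> phase_level 0"
    by (intro phase_level_mult phase_level_comp[OF affine_map_bxor] PQ)
  then show "P \<otimes>\<^bsub>pauli_group\<^esub> Q \<in> carrier pauli_group"
    unfolding carrier_pauli_group by (auto simp: PQ monomial_op_mult bxor_assoc)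
next
  show "\<one>\<^bsub>pauli_group\<^esub> \<in> (carrier pauli_group :: 'n qop set)"
    unfolding carrier_pauli_group
    using phase_level_one[of 0] by (force intro: exI[of _ "\<chi> j. False"])
next
  fix P :: "'n qop"
  assume "P \<in> carrier pauli_group"
  then obtain a f where P: "P = monomial_op (\<lambda>x. bxor x a) f" "f \<in> phase_level 0"
    by (rule pauli_groupE)
  have "dagger P \<in> carrier pauli_group"
    unfolding carrier_pauli_group P(1) dagger_monomial_op[OF bij_bxor] inv_bxor
    using phase_level_cnj[OF phase_level_comp[OF affine_map_bxor P(2)]] by blast
  moreover have "dagger P ** P = mat 1"
    using monomial_op_unitary[of "\<lambda>x. bxor x a" f, OF bij_bxor phase_level_norm[OF P(2)]]
    by (simp add: P(1) unitary_op_def)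
  ultimately show "\<exists>Q\<in>carrier pauli_group. Q \<otimes>\<^bsub>pauli_group\<^esub> P = \<one>\<^bsub>pauli_group\<^esub>"
    by (auto simp: monomial_op_one)
qed (simp_all add: matrix_mul_assoc flip: monomial_op_one)

definition diagonal_paulis :: "'n::finite qop set" where
  "diagonal_paulis = {monomial_op (\<lambda>x. x) f | f. f \<in> phase_level 0}"

text \<open>Diagonal operators multiply pointwise and hence commute. A maximal abelian subgroup
  contained in this group must equal it.\<close>

lemma diagonal_paulis_abelian_subgroup:
  "abelian_subgroup (diagonal_paulis :: 'n::finite qop set) pauli_group"
proof -
  interpret group "pauli_group :: 'n qop monoid"
    by (rule pauli_group_group)
  have subgrp: "subgroup (diagonal_paulis :: 'n qop set) pauli_group"
  proof (rule subgroupI)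
    show "diagonal_paulis \<subseteq> (carrier pauli_group :: 'n qop set)"
      unfolding carrier_pauli_group diagonal_paulis_def
      by (force intro: exI[of _ "\<chi> j. False"])
    then have sub: "monomial_op (\<lambda>x. x) f \<in> (carrier pauli_group :: 'n qop set)"
      if "f \<in> phase_level 0" for f
      using that unfolding diagonal_paulis_def by blast
    show "(diagonal_paulis :: 'n qop set) \<noteq> {}"
      unfolding diagonal_paulis_def using phase_level_one by blast
    fix P Q :: "'n qop"
    assume "P \<in> diagonal_paulis"
    then obtain f where P: "P = monomial_op (\<lambda>x. x) f" "f \<in> phase_level 0"
      unfolding diagonal_paulis_def by blast
    have "cnj (f x) * f x = 1" for x
      using phase_level_norm[OF P(2), of x] by (simp add: complex_norm_square[symmetric] mult.commute)
    then have "inv\<^bsub>pauli_group\<^esub> P = monomial_op (\<lambda>x. x) (\<lambda>x. cnj (f x))"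
      by (intro inv_equality sub phase_level_cnj P(2)) (simp_all add: P monomial_op_mult sub)
    then show "inv\<^bsub>pauli_group\<^esub> P \<in> diagonal_paulis"
      unfolding diagonal_paulis_def using phase_level_cnj[OF P(2)] by blast
    assume "Q \<in> diagonal_paulis"
    then obtain g where Q: "Q = monomial_op (\<lambda>x. x) g" "g \<in> phase_level 0"
      unfolding diagonal_paulis_def by blast
    show "P \<otimes>\<^bsub>pauli_group\<^esub> Q \<in> diagonal_paulis"
      unfolding diagonal_paulis_def
      using phase_level_mult[OF P(2) Q(2)] by (auto simp: P Q monomial_op_mult)
  qed
  moreover have "comm_group (pauli_group\<lparr>carrier := (diagonal_paulis :: 'n qop set)\<rparr>)"
    by (rule group.group_comm_groupI[OF subgroup_imp_group[OF subgrp]])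
      (auto simp: diagonal_paulis_def monomial_op_mult mult.commute)
  ultimately show ?thesis
    by (simp add: abelian_subgroup_def)
qed

lemma W_gate_not_semi_Clifford: "\<not> semi_Clifford (W_gate (m + 3))"
proof
  assume "semi_Clifford (W_gate (m + 3))"
  then obtain G where G: "maximal_abelian_subgroup G pauli_group"
    and "maximal_abelian_subgroup (conj_op (W_gate (m + 3)) ` G) pauli_group"
    unfolding semi_Clifford_def by blast
  then have sub: "G \<subseteq> carrier pauli_group" "conj_op (W_gate (m + 3)) ` G \<subseteq> carrier pauli_group"
    unfolding maximal_abelian_subgroup_def abelian_subgroup_def by (blast dest: subgroup.subset)+
  \<comment> \<open>Every element of \<open>G\<close> is a Pauli whose conjugate is again a Pauli,
    so its translation part is zero.\<close>
  have "G \<subseteq> diagonal_paulis"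
  proof
    fix P
    assume "P \<in> G"
    moreover from this obtain a h where P: "P = monomial_op (\<lambda>x. bxor x a) h" "h \<in> phase_level 0"
      using sub(1) by (blast elim: pauli_groupE)
    ultimately have "a = (\<chi> j. False)"
      using conj_W_gate_pauli_imp_diagonal sub(2) by blast
    then show "P \<in> diagonal_paulis"
      using P unfolding diagonal_paulis_def by (auto)
  qed
  then have "G = diagonal_paulis"
    using G diagonal_paulis_abelian_subgroup unfolding maximal_abelian_subgroup_def by blast
  then have "monomial_op (\<lambda>x. x) (\<lambda>x. sgn_bit (x $ 3)) \<in> G"
    unfolding diagonal_paulis_def using phase_level_sgn[OF affine_bit_nth] by blast
  then show False
    using sub(2) conj_W_gate_Z3_not_pauli[of "m + 2"] by (auto simp: numeral_3_eq_3)
qed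

theorem proposition6:
  fixes k :: nat
  assumes "k \<ge> 3"
  shows "W_gate k \<in> gate_hierarchy (k + 1) \<and> \<not> semi_Clifford (W_gate k)"
proof -
  obtain m where k: "k = m + 3"
    using assms by (metis add.commute le_iff_add)
  then have "k = Suc (Suc (m + 1))" "k + 1 = Suc (Suc (Suc (m + 1)))"
    by simp_all
  then have "W_gate k \<in> gate_hierarchy (k + 1)"
    using W_gate_in_hierarchy[of "m + 1"] by (simp only:)
  then show ?thesis
    using W_gate_not_semi_Clifford[of m] k by blast
qed

end
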